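(* Let $\Phi := \{\varphi_i\}_{i \in I}$ be a spanning Bessel sequence of vectors in $\mathscr{H}$. Then the following are equivalent: (i) For every $\sigma \subset I$ and for every $x \in \mathscr{H}$, $$\left\lVert \sum_{i \in \sigma} \langle x, \varphi_i\rangle \varphi_i \right\rVert \leq \left\lVert \sum_{i \in I} \langle x, \varphi_i\rangle \varphi_i \right\rVert .$$ (ii) For any sequence $\{\varepsilon_i\}_{i\in I}$ with $\varepsilon_i \in \{-1,1\}$ and for every $x \in \mathscr{H}$, $$\left\lVert \sum_{i \in I} \varepsilon_i \langle x, \varphi_i\rangle \varphi_i \right\rVert \leq \left\lVert \sum_{i \in I} \langle x, \varphi_i\rangle \varphi_i \right\rVert .$$ (iii) For every sequence of real numbers $\{a_i\}_{i \in I}$ with $|a_i| \leq 1$ for all $i$ and for every $x \in \mathscr{H}$, $$\left\lVert \sum_{i \in I} a_i \langle x, \varphi_i\rangle \varphi_i \right\rVert \leq \left\lVert \sum_{i \in I} \langle x, \varphi_i\rangle \varphi_i \right\rVert .$$ (iv) There is a partition $\{\mu_j\}_{j \in J}$ of $I$ satisfying: (a) for every $j \in J$, $\{\varphi_i\}_{i \in \mu_j}$ is a tight frame for its closed span; and (b) for any $j_1,j_2 \in J$ with $j_1 \neq j_2$, it follows that $\langle \varphi_{k_1}, \varphi_{k_2}\rangle = 0$ for any $k_1 \in \mu_{j_1}$ and $k_2 \in \mu_{j_2}$. In other words, $\mathscr{H} = \left( \sum_{j \in J} \oplus\, \overline{\operatorname{span}}\{\varphi_i : i \in \mu_j\} \right)_{\ell^2}$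 (orthogonal Hilbert space direct sum), where $\{\varphi_i\}_{i \in \mu_j}$ is a tight frame for $\overline{\operatorname{span}}\{\varphi_i : i \in \mu_j\}$. Hence, when any of the equivalent conditions (i), (ii), (iii), (iv) holds, $\Phi$ is a frame if and only if the infimum of the tight frame bounds (of the families $\{\varphi_i\}_{i\in\mu_j}$, $j\in J$, in (iv)) is not equal to zero.
   Context: $\mathscr{H}$ is a separable, finite or infinite dimensional, real or complex Hilbert space. The index set $I$ is either $\{1,\dots,N\}$ or $\mathbb{N}$. A family $\{\varphi_i\}_{i\in I}$ in $\mathscr{H}$ is Bessel (with bound $B$) if there is $B<\infty$ with $\sum_{i\in I}|\langle x,\varphi_i\rangle|^2\le B\|x\|^2$ for all $x\in\mathscr{H}$; it is a frame for $\mathscr{H}$ if there are constants $0<A\le B<\infty$ with $A\|x\|^2\le \sum_{i\in I}|\langle x,\varphi_i\rangle|^2\le B\|x\|^2$ for all $x\in\mathscr{H}$; it is a tight frame if $A=B$, and this common value is its tight frame bound. Stated frame bounds are always assumed optimal (largest $A$, smallest $B$). "Frame for its closed span" means a frame for the Hilbert space that is the closed linear span of the family. "Spanning" means that the closed linear span of the family is $\mathscr{H}$. *)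

theory Defs
  imports "HOL-Analysis.Analysis" "HOL-Library.Disjoint_Sets"
begin

text \<open>
  The scalar field of a real or complex Hilbert space. By the Gelfand--Mazur theorem every real
  normed field is isomorphic to the reals or to the complex numbers, and the law
  \<open>conjg x * x = \<bar>x\<bar>\<^sup>2\<close> forces \<open>conjg\<close> to be the identity, respectively complex conjugation.
\<close>

class real_or_complex = real_normed_field +
  fixes conjg :: "'a \<Rightarrow> 'a"
  assumes conjg_add: "conjg (x + y) = conjg x + conjg y"
    and conjg_mult: "conjg (x * y) = conjg x * conjg y"
    and conjg_mult_self: "conjg x * x = (norm x)\<^sup>2 *\<^sub>R 1"

instantiation real :: real_or_complex
begin

definition conjg_real :: "real \<Rightarrow> real" where "conjg_real x = x"

instance by standard (simp_all add: conjg_real_def power2_eq_square)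

end

instantiation complex :: real_or_complex
begin

definition conjg_complex :: "complex \<Rightarrow> complex" where "conjg_complex = cnj"

instance
  by standard
    (simp_all add: conjg_complex_def scaleR_conv_of_real complex_norm_square mult.commute del: of_real_power)

end

text \<open>
  The library has inner product spaces over the reals only. Here the carrier is a Banach space
  over the reals, equipped with a scalar multiplication by the scalar field that extends \<open>(*\<^sub>R)\<close> and
  an inner product (linear in the first, conjugate linear in the second argument) that induces
  the given norm.
\<close>

locale hilbert_space = vector_space scl
  for scl :: "'k::real_or_complex \<Rightarrow> 'h::banach \<Rightarrow> 'h" +
  fixes ip :: "'h \<Rightarrow> 'h \<Rightarrow> 'k"
  assumes scale_of_real: "scl (of_real r) x = r *\<^sub>R x"
    and ip_add_left: "ip (x + y) z = ip x z + ip y z"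
    and ip_scale_left: "ip (scl c x) y = c * ip x y"
    and ip_conj: "ip y x = conjg (ip x y)"
    and ip_self: "ip x x = of_real ((norm x)\<^sup>2)"

lemma hilbert_space_real_inner:
  "hilbert_space ((*\<^sub>R) :: real \<Rightarrow> 'h \<Rightarrow> 'h::{real_inner,banach}) inner"
  by standard (simp_all add: inner_add_left inner_commute conjg_real_def dot_square_norm algebra_simps)

lemma hilbert_space_complex: "hilbert_space ((*) :: complex \<Rightarrow> complex \<Rightarrow> complex) (\<lambda>x y. x * cnj y)"
  by standard
    (simp_all add: conjg_complex_def algebra_simps scaleR_conv_of_real complex_norm_square
      del: of_real_power)

definition bessel :: "('h::real_normed_vector \<Rightarrow> 'h \<Rightarrow> 'k::real_or_complex) \<Rightarrow> (nat \<Rightarrow> 'h) \<Rightarrow> nat set \<Rightarrow> bool"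
  where "bessel ip \<phi> I \<longleftrightarrow>
    (\<exists>B. \<forall>x. (\<lambda>i. (norm (ip x (\<phi> i)))\<^sup>2) summable_on I \<and>
      (\<Sum>\<^sub>\<infinity>i\<in>I. (norm (ip x (\<phi> i)))\<^sup>2) \<le> B * (norm x)\<^sup>2)"

definition closed_span :: "('k::field \<Rightarrow> 'h::real_normed_vector \<Rightarrow> 'h) \<Rightarrow> (nat \<Rightarrow> 'h) \<Rightarrow> nat set \<Rightarrow> 'h set"
  where "closed_span scl \<phi> I = closure (module.span scl (\<phi> ` I))"

text \<open>\<open>V\<close> is the Hilbert space for which the family is a frame: the whole space, or a closed subspace.\<close>

definition frame_bounds ::
  "('h::real_normed_vector \<Rightarrow> 'h \<Rightarrow> 'k::real_or_complex) \<Rightarrow> (nat \<Rightarrow> 'h) \<Rightarrow> nat set \<Rightarrow> 'h set \<Rightarrow> real \<Rightarrow> real \<Rightarrow> bool"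
  where "frame_bounds ip \<phi> I V A B \<longleftrightarrow>
    \<phi> ` I \<subseteq> V \<and> 0 < A \<and> A \<le> B \<and>
    (\<forall>x\<in>V. (\<lambda>i. (norm (ip x (\<phi> i)))\<^sup>2) summable_on I \<and>
      A * (norm x)\<^sup>2 \<le> (\<Sum>\<^sub>\<infinity>i\<in>I. (norm (ip x (\<phi> i)))\<^sup>2) \<and>
      (\<Sum>\<^sub>\<infinity>i\<in>I. (norm (ip x (\<phi> i)))\<^sup>2) \<le> B * (norm x)\<^sup>2)"

definition frame_for ::
  "('h::real_normed_vector \<Rightarrow> 'h \<Rightarrow> 'k::real_or_complex) \<Rightarrow> (nat \<Rightarrow> 'h) \<Rightarrow> nat set \<Rightarrow> 'h set \<Rightarrow> bool"
  where "frame_for ip \<phi> I V \<longleftrightarrow> (\<exists>A B. frame_bounds ip \<phi> I V A B)"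

definition tight_frame_for ::
  "('h::real_normed_vector \<Rightarrow> 'h \<Rightarrow> 'k::real_or_complex) \<Rightarrow> (nat \<Rightarrow> 'h) \<Rightarrow> nat set \<Rightarrow> 'h set \<Rightarrow> bool"
  where "tight_frame_for ip \<phi> I V \<longleftrightarrow> (\<exists>A. frame_bounds ip \<phi> I V A A)"

text \<open>
  For \<open>V \<noteq> {0}\<close> the tight frame bound is the unique \<open>A\<close> with \<open>frame_bounds ip \<phi> I V A A\<close>. A family of
  zero vectors is a tight frame for \<open>{0}\<close> with every \<open>A > 0\<close>; taking the largest one gives \<open>\<infinity>\<close>, so
  that such families do not contribute to an infimum of tight frame bounds.
\<close>

definition tight_frame_bound ::
  "('h::real_normed_vector \<Rightarrow> 'h \<Rightarrow> 'k::real_or_complex) \<Rightarrow> (nat \<Rightarrow> 'h) \<Rightarrow> nat set \<Rightarrow> 'h set \<Rightarrow> ereal"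
  where "tight_frame_bound ip \<phi> I V = Sup {ereal A | A. frame_bounds ip \<phi> I V A A}"

definition orthogonal_tight_partition ::
  "('k::real_or_complex \<Rightarrow> 'h::real_normed_vector \<Rightarrow> 'h) \<Rightarrow> ('h \<Rightarrow> 'h \<Rightarrow> 'k) \<Rightarrow> (nat \<Rightarrow> 'h) \<Rightarrow> nat set \<Rightarrow> nat set set \<Rightarrow> bool"
  where "orthogonal_tight_partition scl ip \<phi> I P \<longleftrightarrow>
    partition_on I P \<and>
    (\<forall>\<mu>\<in>P. tight_frame_for ip \<phi> \<mu> (closed_span scl \<phi> \<mu>)) \<and>
    (\<forall>\<mu>\<in>P. \<forall>\<nu>\<in>P. \<mu> \<noteq> \<nu> \<longrightarrow> (\<forall>k\<in>\<mu>. \<forall>l\<in>\<nu>. ip (\<phi> k) (\<phi> l) = 0))"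

text \<open>
  The whole space is the internal Hilbert space direct sum of the closed subspaces \<open>V j\<close>: they are
  mutually orthogonal and every vector is the sum of a square summable family of components.
  Orthogonality makes the components unique and \<open>\<parallel>x\<parallel>\<^sup>2\<close> the sum of the \<open>\<parallel>f j\<parallel>\<^sup>2\<close>.
\<close>

definition hilbert_direct_sum ::
  "('k::real_or_complex \<Rightarrow> 'h::real_normed_vector \<Rightarrow> 'h) \<Rightarrow> ('h \<Rightarrow> 'h \<Rightarrow> 'k) \<Rightarrow> ('j \<Rightarrow> 'h set) \<Rightarrow> 'j set \<Rightarrow> bool"
  where "hilbert_direct_sum scl ip V J \<longleftrightarrow>
    (\<forall>j\<in>J. module.subspace scl (V j) \<and> closed (V j)) \<and>
    (\<forall>j\<in>J. \<forall>k\<in>J. j \<noteq> k \<longrightarrow> (\<forall>x\<in>V j. \<forall>y\<in>V k. ip x y = 0)) \<and>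
    (\<forall>x. \<exists>f. (\<forall>j\<in>J. f j \<in> V j) \<and> (\<lambda>j. (norm (f j))\<^sup>2) summable_on J \<and> (f has_sum x) J)"

end

theory Submission
  imports Defs
begin

text \<open>
  Let \<open>S\<close> be the frame operator \<open>S x = \<Sum>\<^sub>i \<langle>x, \<phi>\<^sub>i\<rangle> \<phi>\<^sub>i\<close>, and for \<open>\<sigma> \<subseteq> I\<close> let \<open>S\<^sub>\<sigma>\<close> be its partial sum
  over \<open>\<sigma>\<close>. All four conditions say that every \<open>\<phi>\<^sub>k\<close> is an eigenvector of \<open>S\<close>.

  Apply (i) or (ii) to a change at a single index: dropping the index \<open>k\<close>, or flipping its sign,
  gives \<open>\<parallel>S x - e \<langle>x, \<phi>\<^sub>k\<rangle> \<phi>\<^sub>k\<parallel> \<le> \<parallel>S x\<parallel>\<close> for all \<open>x\<close>, with \<open>e = 1\<close> or \<open>e = 2\<close>. Squaring, the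
  cross term must dominate: \<open>2 Re (\<langle>x, S \<phi>\<^sub>k\<rangle> \<langle>\<phi>\<^sub>k, x\<rangle>) \<ge> e \<bar>\<langle>x, \<phi>\<^sub>k\<rangle>\<bar>\<^sup>2 \<parallel>\<phi>\<^sub>k\<parallel>\<^sup>2\<close>. If \<open>S \<phi>\<^sub>k\<close> were not a multiple
  of \<open>\<phi>\<^sub>k\<close>, one could prescribe \<open>\<langle>x, \<phi>\<^sub>k\<rangle> \<noteq> 0\<close> and \<open>\<langle>x, S \<phi>\<^sub>k\<rangle> = 0\<close> at the same time, which is a
  contradiction (\<open>eigenvector_of_frame_op\<close>). Now group the indices by eigenvalue. Since \<open>S\<close> is
  self-adjoint, different cells \<open>\<mu>\<close> are orthogonal, so that \<open>S\<close> agrees with \<open>S\<^sub>\<mu>\<close> on the closed span of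
  the cell, where both are multiplication by the eigenvalue; and this is what it means to be a tight
  frame (\<open>tight_frame_bounds_iff\<close>). This gives (iv).

  Conversely, in (iv) the operator \<open>S\<^sub>\<mu>\<close> is \<open>A\<^sub>\<mu>\<close> times the orthogonal projection onto the closed span of
  the cell. Within a cell a multiplier of modulus at most one does not increase \<open>\<parallel>S\<^sub>\<mu> x\<parallel>\<close>, because the
  synthesis operator has norm at most \<open>\<surd>A\<^sub>\<mu>\<close> while \<open>\<parallel>S\<^sub>\<mu> x\<parallel>\<^sup>2 = A\<^sub>\<mu> \<Sum>\<^sub>i \<bar>\<langle>x, \<phi>\<^sub>i\<rangle>\<bar>\<^sup>2\<close>
  (\<open>tight_multiplier_norm_le\<close>). Pythagoras puts the cells together and yields (iii), which contains
  both (i) and (ii).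

  The vectors \<open>S\<^sub>\<mu> x / A\<^sub>\<mu>\<close> are the components of \<open>x\<close> in the orthogonal direct sum (\<open>tight_components\<close>),
  and \<open>\<Sum>\<^sub>i \<bar>\<langle>x, \<phi>\<^sub>i\<rangle>\<bar>\<^sup>2\<close> is the sum of their squared norms weighted by the bounds \<open>A\<^sub>\<mu>\<close>. Hence a lower
  frame bound for the whole family is the same as a common positive lower bound of the tight
  frame bounds.
\<close>

section \<open>Unconditional sums in Banach spaces\<close>

lemma norm_le_of_square_le_mult:
  fixes a b :: real
  assumes "a\<^sup>2 \<le> b * a" "0 \<le> a" "0 \<le> b"
  shows "a \<le> b"
  using assms by (cases "a = 0") (auto simp: power2_eq_square)

text \<open>
  The domination is between the squared norm of a partial sum and a summable series, hence it does
  not give absolute convergence. It makes the net of partial sums Cauchy, since it also applies to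
  the difference of two partial sums.
\<close>
lemma summable_on_if_norm_sum_le:
  fixes f :: "'a \<Rightarrow> 'b::banach" and g :: "'a \<Rightarrow> real"
  assumes g: "g summable_on A" and g0: "\<And>i. i \<in> A \<Longrightarrow> 0 \<le> g i" and K: "0 \<le> K"
    and bound: "\<And>F. finite F \<Longrightarrow> F \<subseteq> A \<Longrightarrow> (norm (sum f F))\<^sup>2 \<le> K * sum g F"
  shows "f summable_on A"
proof -
  have "\<exists>P. eventually P (finite_subsets_at_top A) \<and>
              (\<forall>F F'. P F \<and> P F' \<longrightarrow> dist (sum f F) (sum f F') < e)" if "e > 0" for e
  proof -
    define d where "d = (e/2)\<^sup>2 / (K + 1)"
    have d: "d > 0"
      using that K by (auto simp: d_def)
    obtain F0 where F0: "finite F0" "F0 \<subseteq> A" and approx: "dist (sum g F0) (infsum g A) \<le> d / 2"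
      using infsum_finite_approximation[OF g, of "d/2"] d by auto
    have near: "dist (sum f F) (sum f F0) < e / 2" if F: "finite F" "F0 \<subseteq> F" "F \<subseteq> A" for F
    proof -
      have "sum g F \<le> infsum g A"
        using finite_sum_le_infsum[OF g F(1) F(3)] g0 by auto
      moreover have "sum g (F - F0) = sum g F - sum g F0"
        using F F0 by (simp add: sum_diff)
      ultimately have tail: "sum g (F - F0) < d"
        using approx d unfolding dist_real_def by linarith
      have "(norm (sum f (F - F0)))\<^sup>2 \<le> K * sum g (F - F0)"
        using F by (intro bound) auto
      also have "\<dots> \<le> K * d"
        using tail K by (intro mult_left_mono) auto
      also have "\<dots> < (K + 1) * d"
        using d by (simp add: algebra_simps)
      also have "\<dots> = (e/2)\<^sup>2"
        using K by (simp add: d_def)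
      finally have "norm (sum f (F - F0)) < e / 2"
        using \<open>e > 0\<close> by (intro power_less_imp_less_base[of _ 2 "e / 2"]) simp_all
      then show ?thesis
        using F F0 by (simp add: dist_norm sum_diff)
    qed
    show ?thesis
    proof (intro exI conjI allI impI)
      show "\<forall>\<^sub>F F in finite_subsets_at_top A. finite F \<and> F0 \<subseteq> F \<and> F \<subseteq> A"
        using F0 by (auto simp: eventually_finite_subsets_at_top)
      fix F F' assume "(finite F \<and> F0 \<subseteq> F \<and> F \<subseteq> A) \<and> finite F' \<and> F0 \<subseteq> F' \<and> F' \<subseteq> A"
      then show "dist (sum f F) (sum f F') < e"
        using near[of F] near[of F'] dist_triangle2[of "sum f F" "sum f F'" "sum f F0"] by force
    qed
  qed
  then have "cauchy_filter (filtermap (sum f) (finite_subsets_at_top A))"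
    by (simp add: cauchy_filter_metric_filtermap)
  moreover have "complete (UNIV :: 'b set)"
    by (meson Cauchy_convergent UNIV_I complete_def convergent_def)
  ultimately obtain L where "(sum f \<longlongrightarrow> L) (finite_subsets_at_top A)"
    using complete_uniform[where S=UNIV] by (force simp add: filterlim_def)
  then show ?thesis
    using summable_on_def has_sum_def by blast
qed

lemma has_sum_in_closed:
  assumes "(f has_sum s) A" "closed W" "\<And>F. finite F \<Longrightarrow> F \<subseteq> A \<Longrightarrow> sum f F \<in> W"
  shows "s \<in> W"
  using assms unfolding has_sum_def
  by (intro Lim_in_closed_set[of W "sum f" "finite_subsets_at_top A"])
     (auto intro: eventually_finite_subsets_at_top_weakI)

text \<open>The cells are disjoint, so \<open>I\<close> is in bijection with the disjoint union of the cells of \<open>P\<close>.\<close>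
lemma has_sum_partition:
  fixes f :: "'a \<Rightarrow> 'b::banach"
  assumes P: "partition_on I P" and f: "f summable_on I"
  shows "((\<lambda>\<mu>. infsum f \<mu>) has_sum infsum f I) P"
proof -
  have img: "snd ` Sigma P (\<lambda>\<mu>. \<mu>) = I"
    unfolding partition_onD1[OF P] by (simp add: snd_image_Sigma)
  moreover have "inj_on snd (Sigma P (\<lambda>\<mu>. \<mu>))"
    using partition_onD2[OF P] by (auto simp: inj_on_def disjoint_def)
  ultimately have bij: "bij_betw snd (Sigma P (\<lambda>\<mu>. \<mu>)) I"
    by (simp add: bij_betw_def)
  have "((\<lambda>p. f (snd p)) has_sum infsum f I) (Sigma P (\<lambda>\<mu>. \<mu>))"
    by (simp add: has_sum_reindex_bij_betw[OF bij] f)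
  moreover have "f summable_on \<mu>" if "\<mu> \<in> P" for \<mu>
    using f by (rule summable_on_subset_banach) (use that partition_onD1[OF P] in auto)
  ultimately show ?thesis
    using has_sum_Sigma[OF isUCont_plus,
        where f = "\<lambda>p. f (snd p)" and a = "infsum f I" and A = P and B = "\<lambda>\<mu>. \<mu>" and b = "infsum f"]
    by simp
qed

section \<open>Elementary geometry of the inner product\<close>

context hilbert_space
begin

lemma conjg_zero [simp]: "conjg (0 :: 'k) = 0"
  using conjg_add[of "0 :: 'k" 0] by simp

lemma conjg_of_real [simp]: "conjg (of_real r :: 'k) = of_real r"
proof (cases "r = 0")
  case False
  have "conjg (of_real r :: 'k) * of_real r = of_real r * of_real r"
    using conjg_mult_self[of "of_real r :: 'k"]
    by (simp add: scaleR_conv_of_real power2_eq_square flip: of_real_mult)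
  with False show ?thesis by simp
qed simp

lemma norm_conjg [simp]: "norm (conjg (c :: 'k)) = norm c"
proof (cases "c = 0")
  case False
  have "norm (conjg c) * norm c = norm c * norm c"
    using arg_cong[OF conjg_mult_self[of c], of norm] by (simp add: norm_mult power2_eq_square)
  with False show ?thesis by simp
qed simp

lemma mult_conjg: "(c :: 'k) * conjg c = of_real ((norm c)\<^sup>2)"
  using conjg_mult_self[of c] by (simp add: scaleR_conv_of_real mult.commute)

lemma ip_zero_left [simp]: "ip 0 y = 0"
  using ip_add_left[of 0 0 y] by simp

lemma ip_zero_right [simp]: "ip x 0 = 0"
  by (metis ip_conj ip_zero_left conjg_zero)

lemma ip_minus_left: "ip (- x) y = - ip x y"
  using ip_add_left[of x "- x" y] by (simp add: eq_neg_iff_add_eq_0 add.commute)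

lemma ip_diff_left: "ip (x - y) z = ip x z - ip y z"
  using ip_add_left[of x "- y" z] by (simp add: ip_minus_left)

lemma ip_add_right: "ip x (y + z) = ip x y + ip x z"
  by (metis ip_conj ip_add_left conjg_add)

lemma ip_minus_right: "ip x (- y) = - ip x y"
  using ip_add_right[of x y "- y"] by (simp add: eq_neg_iff_add_eq_0 add.commute)

lemma ip_diff_right: "ip x (y - z) = ip x y - ip x z"
  using ip_add_right[of x y "- z"] by (simp add: ip_minus_right)

lemma ip_scale_right: "ip x (scl c y) = conjg c * ip x y"
  by (metis ip_conj ip_scale_left conjg_mult)

lemma ip_scaleR_left: "ip (r *\<^sub>R x) y = of_real r * ip x y"
  by (metis scale_of_real ip_scale_left)

lemma ip_scaleR_right: "ip x (r *\<^sub>R y) = of_real r * ip x y"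
  by (metis scale_of_real ip_scale_right conjg_of_real)

lemma ip_sum_left: "ip (sum f F) y = (\<Sum>i\<in>F. ip (f i) y)"
  by (induction F rule: infinite_finite_induct) (simp_all add: ip_add_left)

lemma ip_sum_right: "ip x (sum f F) = (\<Sum>i\<in>F. ip x (f i))"
  by (induction F rule: infinite_finite_induct) (simp_all add: ip_add_right)

lemma ip_commute_zero: "ip x y = 0 \<Longrightarrow> ip y x = 0"
  by (metis ip_conj conjg_zero)

lemma ip_self_zero_iff [simp]: "ip x x = 0 \<longleftrightarrow> x = 0"
  by (simp add: ip_self)

lemma norm_scl: "norm (scl c x) = norm c * norm x"
proof -
  have "ip (scl c x) (scl c x) = (c * conjg c) * ip x x"
    by (simp add: ip_scale_left ip_scale_right)
  also have "\<dots> = of_real ((norm c * norm x)\<^sup>2)"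
    by (simp only: mult_conjg ip_self power_mult_distrib of_real_mult)
  finally have "(norm (scl c x))\<^sup>2 = (norm c * norm x)\<^sup>2"
    unfolding ip_self of_real_eq_iff .
  then show ?thesis
    by simp
qed

lemma Cauchy_Schwarz: "norm (ip x y) \<le> norm x * norm y"
proof (cases "y = 0")
  case False
  define c where "c = ip x y"
  define n where "n = (norm y)\<^sup>2"
  define z where "z = x - scl (c / of_real n) y"
  have n: "n > 0"
    using False by (simp add: n_def)
  have "ip z y = 0"
    using n by (simp add: z_def ip_diff_left ip_scale_left ip_self c_def flip: n_def)
  then have "ip z z = ip z x"
    by (simp add: z_def ip_diff_right ip_scale_right)
  also have "\<dots> = of_real ((norm x)\<^sup>2) - c * conjg c / of_real n"
    by (simp add: z_def ip_diff_left ip_scale_left ip_self c_def flip: ip_conj)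
  also have "\<dots> = of_real ((norm x)\<^sup>2 - (norm c)\<^sup>2 / n)"
    by (simp add: mult_conjg)
  finally have "(norm z)\<^sup>2 = (norm x)\<^sup>2 - (norm c)\<^sup>2 / n"
    unfolding ip_self of_real_eq_iff .
  then have "(norm c)\<^sup>2 / n \<le> (norm x)\<^sup>2"
    by (metis diff_ge_0_iff_ge zero_le_power2)
  then have "(norm c)\<^sup>2 \<le> (norm x * norm y)\<^sup>2"
    using n by (simp add: field_simps n_def)
  then show ?thesis
    by (simp add: c_def power2_le_iff_abs_le)
qed simp

lemma bounded_linear_ip_left: "bounded_linear (\<lambda>x. ip x y)"
  by (rule bounded_linear_intro[where K = "norm y"])
     (simp_all add: ip_add_left ip_scaleR_left scaleR_conv_of_real Cauchy_Schwarz)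

lemma bounded_linear_ip_right: "bounded_linear (\<lambda>y. ip x y)"
  by (rule bounded_linear_intro[where K = "norm x"])
     (simp_all add: ip_add_right ip_scaleR_right scaleR_conv_of_real Cauchy_Schwarz mult.commute[of _ "norm x"])

lemma bounded_linear_scl: "bounded_linear (scl c)"
proof (rule bounded_linear_intro[where K = "norm c"])
  show "scl c (r *\<^sub>R x) = r *\<^sub>R scl c x" for r x
    by (metis scale_of_real scale_left_commute)
qed (simp_all add: scale_right_distrib norm_scl mult.commute)

text \<open>
  The general scalar field has no real part, so the law of cosines is stated only for vectors whose
  inner product is real.
\<close>
lemma norm_diff_scaleR_square:
  assumes "ip a b = of_real r"
  shows "(norm (a - t *\<^sub>R b))\<^sup>2 = (norm a)\<^sup>2 - 2 * t * r + t\<^sup>2 * (norm b)\<^sup>2"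
proof -
  have "ip b a = of_real r"
    by (metis assms ip_conj conjg_of_real)
  then have "ip (a - t *\<^sub>R b) (a - t *\<^sub>R b) = ip a a - 2 * of_real t * of_real r + (of_real t)\<^sup>2 * ip b b"
    using assms
    by (simp add: ip_diff_left ip_diff_right ip_scaleR_left ip_scaleR_right power2_eq_square algebra_simps)
  also have "\<dots> = of_real ((norm a)\<^sup>2 - 2 * t * r + t\<^sup>2 * (norm b)\<^sup>2)"
    by (simp add: ip_self)
  finally show ?thesis
    unfolding ip_self of_real_eq_iff .
qed

lemma norm_sum_orthogonal_square:
  assumes "finite F" and "\<And>i j. i \<in> F \<Longrightarrow> j \<in> F \<Longrightarrow> i \<noteq> j \<Longrightarrow> ip (f i) (f j) = 0"
  shows "(norm (sum f F))\<^sup>2 = (\<Sum>i\<in>F. (norm (f i))\<^sup>2)"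
proof -
  have "ip (sum f F) (sum f F) = (\<Sum>i\<in>F. \<Sum>j\<in>F. ip (f i) (f j))"
    by (simp only: ip_sum_left, simp only: ip_sum_right)
  also have "\<dots> = (\<Sum>i\<in>F. \<Sum>j\<in>F. if j = i then ip (f i) (f i) else 0)"
    using assms by (intro sum.cong) auto
  also have "\<dots> = of_real (\<Sum>i\<in>F. (norm (f i))\<^sup>2)"
    using assms(1) by (simp add: ip_self)
  finally show ?thesis
    unfolding ip_self of_real_eq_iff .
qed

lemma has_sum_norm_square_orthogonal:
  assumes "(f has_sum s) J" and "\<And>i j. i \<in> J \<Longrightarrow> j \<in> J \<Longrightarrow> i \<noteq> j \<Longrightarrow> ip (f i) (f j) = 0"
  shows "((\<lambda>i. (norm (f i))\<^sup>2) has_sum (norm s)\<^sup>2) J"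
proof -
  have "((\<lambda>F. (norm (sum f F))\<^sup>2) \<longlongrightarrow> (norm s)\<^sup>2) (finite_subsets_at_top J)"
    using assms(1) unfolding has_sum_def by (intro tendsto_intros)
  moreover have "\<forall>\<^sub>F F in finite_subsets_at_top J. (norm (sum f F))\<^sup>2 = (\<Sum>i\<in>F. (norm (f i))\<^sup>2)"
    using assms(2) by (intro eventually_finite_subsets_at_top_weakI norm_sum_orthogonal_square) blast+
  ultimately show ?thesis
    unfolding has_sum_def by (rule Lim_transform_eventually)
qed

section \<open>Closed spans\<close>

lemma subspace_closed_span: "subspace (closed_span scl \<phi> \<sigma>)"
proof -
  have W: "subspace (span (\<phi> ` \<sigma>))"
    by (rule subspace_span)
  show ?thesis
    unfolding closed_span_def
  proof (rule subspaceI)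
    show "0 \<in> closure (span (\<phi> ` \<sigma>))"
      using subspace_0[OF W] closure_subset by blast
  next
    fix x y assume "x \<in> closure (span (\<phi> ` \<sigma>))" "y \<in> closure (span (\<phi> ` \<sigma>))"
    then obtain f g where fg: "\<And>n. f n \<in> span (\<phi> ` \<sigma>)" "f \<longlonglongrightarrow> x" "\<And>n. g n \<in> span (\<phi> ` \<sigma>)" "g \<longlonglongrightarrow> y"
      unfolding closure_sequential by blast
    have "(\<lambda>n. f n + g n) \<longlonglongrightarrow> x + y"
      using fg by (intro tendsto_intros)
    then show "x + y \<in> closure (span (\<phi> ` \<sigma>))"
      unfolding closure_sequential using fg(1,3)
      by (intro exI[of _ "\<lambda>n. f n + g n"] conjI allI subspace_add[OF W])
  next
    fix c x assume "x \<in> closure (span (\<phi> ` \<sigma>))"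
    then obtain f where f: "\<And>n. f n \<in> span (\<phi> ` \<sigma>)" "f \<longlonglongrightarrow> x"
      unfolding closure_sequential by blast
    have "(\<lambda>n. scl c (f n)) \<longlonglongrightarrow> scl c x"
      using f(2) by (rule bounded_linear.tendsto[OF bounded_linear_scl])
    then show "scl c x \<in> closure (span (\<phi> ` \<sigma>))"
      unfolding closure_sequential using f(1)
      by (intro exI[of _ "\<lambda>n. scl c (f n)"] conjI allI subspace_scale[OF W])
  qed
qed

lemma closed_closed_span: "closed (closed_span scl \<phi> \<sigma>)"
  by (simp add: closed_span_def)

lemma in_closed_span: "i \<in> \<sigma> \<Longrightarrow> \<phi> i \<in> closed_span scl \<phi> \<sigma>"
  unfolding closed_span_def by (rule subsetD[OF closure_subset]) (simp add: span_base)

lemma scaleR_in_closed_span: "x \<in> closed_span scl \<phi> \<sigma> \<Longrightarrow> r *\<^sub>R x \<in> closed_span scl \<phi> \<sigma>"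
  using subspace_scale[OF subspace_closed_span] by (metis scale_of_real)

lemma has_sum_in_closed_span:
  assumes "((\<lambda>i. scl (c i) (\<phi> i)) has_sum s) \<sigma>"
  shows "s \<in> closed_span scl \<phi> \<sigma>"
  using assms closed_closed_span
  by (rule has_sum_in_closed)
     (blast intro: subspace_sum[OF subspace_closed_span] subspace_scale[OF subspace_closed_span] in_closed_span)

lemma orthogonal_closed_span:
  assumes "\<And>i. i \<in> \<sigma> \<Longrightarrow> ip x (\<phi> i) = 0" and y: "y \<in> closed_span scl \<phi> \<sigma>"
  shows "ip x y = 0"
proof -
  have "subspace {y. ip x y = 0}"
    by (rule subspaceI) (auto simp: ip_add_right ip_scale_right)
  moreover have "\<phi> ` \<sigma> \<subseteq> {y. ip x y = 0}"
    using assms(1) by blast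
  ultimately have "span (\<phi> ` \<sigma>) \<subseteq> {y. ip x y = 0}"
    by (rule span_minimal[rotated])
  moreover have "closed {y. ip x y = 0}"
    using bounded_linear.continuous_on[OF bounded_linear_ip_right continuous_on_id]
    by (intro closed_Collect_eq continuous_on_const) auto
  ultimately have "closed_span scl \<phi> \<sigma> \<subseteq> {y. ip x y = 0}"
    unfolding closed_span_def by (rule closure_minimal)
  with y show ?thesis by blast
qed

lemma orthogonal_closed_spans:
  assumes "\<And>i j. i \<in> \<sigma> \<Longrightarrow> j \<in> \<tau> \<Longrightarrow> ip (\<phi> i) (\<phi> j) = 0"
    and "x \<in> closed_span scl \<phi> \<sigma>" "y \<in> closed_span scl \<phi> \<tau>"
  shows "ip x y = 0"
proof (rule orthogonal_closed_span[OF _ assms(3)])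
  fix j assume "j \<in> \<tau>"
  then have "ip (\<phi> j) x = 0"
    using assms by (intro orthogonal_closed_span[OF _ assms(2)]) (blast intro: ip_commute_zero)
  then show "ip x (\<phi> j) = 0"
    by (rule ip_commute_zero)
qed

end

section \<open>The frame operator of a Bessel family\<close>

context hilbert_space
begin

text \<open>
  The quadratic form of the frame operator; frame bounds compare it with the squared norm.
\<close>
definition energy :: "(nat \<Rightarrow> 'h) \<Rightarrow> nat set \<Rightarrow> 'h \<Rightarrow> real"
  where "energy \<phi> \<sigma> x = (\<Sum>\<^sub>\<infinity>i\<in>\<sigma>. (norm (ip x (\<phi> i)))\<^sup>2)"

definition frame_op :: "(nat \<Rightarrow> 'h) \<Rightarrow> nat set \<Rightarrow> 'h \<Rightarrow> 'h"
  where "frame_op \<phi> \<sigma> x = (\<Sum>\<^sub>\<infinity>i\<in>\<sigma>. scl (ip x (\<phi> i)) (\<phi> i))"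

lemma bessel_summable:
  "bessel ip \<phi> \<sigma> \<Longrightarrow> (\<lambda>i. (norm (ip x (\<phi> i)))\<^sup>2) summable_on \<sigma>"
  by (auto simp: bessel_def)

lemma energy_nonneg: "0 \<le> energy \<phi> \<sigma> x"
  unfolding energy_def by (rule infsum_nonneg) simp

lemma energy_has_sum:
  "bessel ip \<phi> \<sigma> \<Longrightarrow> ((\<lambda>i. (norm (ip x (\<phi> i)))\<^sup>2) has_sum energy \<phi> \<sigma> x) \<sigma>"
  unfolding energy_def by (simp add: bessel_summable)

lemma energy_mono:
  assumes "bessel ip \<phi> I" "\<sigma> \<subseteq> I"
  shows "energy \<phi> \<sigma> x \<le> energy \<phi> I x"
  unfolding energy_def
  using assms by (intro infsum_mono2) (auto intro: bessel_summable summable_on_subset_banach)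

lemma bessel_bound:
  assumes "bessel ip \<phi> \<sigma>"
  obtains B where "0 \<le> B" "\<And>x. energy \<phi> \<sigma> x \<le> B * (norm x)\<^sup>2"
proof -
  obtain B where B: "\<And>x. energy \<phi> \<sigma> x \<le> B * (norm x)\<^sup>2"
    using assms by (auto simp: bessel_def energy_def)
  have "energy \<phi> \<sigma> x \<le> \<bar>B\<bar> * (norm x)\<^sup>2" for x
    using B[of x] by (rule order_trans) (simp add: mult_right_mono)
  then show ?thesis
    by (intro that[of "\<bar>B\<bar>"]) auto
qed

lemma bessel_subset:
  assumes I: "bessel ip \<phi> I" and "\<sigma> \<subseteq> I"
  shows "bessel ip \<phi> \<sigma>"
proof -
  obtain B where "\<And>x. energy \<phi> I x \<le> B * (norm x)\<^sup>2"
    using bessel_bound[OF I] by blast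
  then have "\<forall>x. energy \<phi> \<sigma> x \<le> B * (norm x)\<^sup>2"
    using energy_mono[OF assms] order_trans by blast
  moreover have "(\<lambda>i. (norm (ip x (\<phi> i)))\<^sup>2) summable_on \<sigma>" for x
    using bessel_summable[OF I] assms(2) by (rule summable_on_subset_banach)
  ultimately show ?thesis
    unfolding bessel_def energy_def by blast
qed

lemma energy_ge_term:
  assumes "bessel ip \<phi> \<sigma>" "k \<in> \<sigma>"
  shows "(norm (ip x (\<phi> k)))\<^sup>2 \<le> energy \<phi> \<sigma> x"
  using finite_sum_le_has_sum[OF energy_has_sum[OF assms(1)], of "{k}"] assms(2) by simp

text \<open>
  Synthesis \<open>c \<mapsto> \<Sum>\<^sub>i c\<^sub>i \<phi>\<^sub>i\<close> is adjoint to analysis \<open>z \<mapsto> (\<langle>z, \<phi>\<^sub>i\<rangle>)\<^sub>i\<close> and so has the same norm: pair the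
  synthesized vector with itself and apply the Cauchy--Schwarz inequality to the sequences.
\<close>
lemma norm_synthesis_finite:
  assumes bes: "bessel ip \<phi> \<sigma>" and B: "0 \<le> B" "\<And>x. energy \<phi> \<sigma> x \<le> B * (norm x)\<^sup>2"
    and F: "finite F" "F \<subseteq> \<sigma>"
  shows "(norm (\<Sum>i\<in>F. scl (c i) (\<phi> i)))\<^sup>2 \<le> B * (\<Sum>i\<in>F. (norm (c i))\<^sup>2)"
proof -
  define z where "z = (\<Sum>i\<in>F. scl (c i) (\<phi> i))"
  have "norm (ip z z) = norm (\<Sum>i\<in>F. c i * ip (\<phi> i) z)"
    by (subst (2) z_def) (simp add: z_def ip_sum_left ip_scale_left)
  also have "\<dots> \<le> (\<Sum>i\<in>F. norm (c i) * norm (ip z (\<phi> i)))"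
    by (rule sum_norm_le) (metis ip_conj norm_conjg norm_mult order_refl)
  finally have "((norm z)\<^sup>2)\<^sup>2 \<le> (\<Sum>i\<in>F. norm (c i) * norm (ip z (\<phi> i)))\<^sup>2"
    by (intro power_mono) (simp_all add: ip_self norm_power)
  also have "\<dots> \<le> (\<Sum>i\<in>F. (norm (c i))\<^sup>2) * (\<Sum>i\<in>F. (norm (ip z (\<phi> i)))\<^sup>2)"
    by (rule Cauchy_Schwarz_ineq_sum)
  also have "\<dots> \<le> (\<Sum>i\<in>F. (norm (c i))\<^sup>2) * (B * (norm z)\<^sup>2)"
    using finite_sum_le_has_sum[OF energy_has_sum[OF bes, of z] F] B(2)[of z]
    by (intro mult_left_mono) (auto intro: sum_nonneg)
  finally have "((norm z)\<^sup>2)\<^sup>2 \<le> (B * (\<Sum>i\<in>F. (norm (c i))\<^sup>2)) * (norm z)\<^sup>2"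
    by (simp add: mult_ac)
  then show ?thesis
    unfolding z_def by (rule norm_le_of_square_le_mult) (simp_all add: B(1) sum_nonneg)
qed

lemma synthesis_summable:
  assumes bes: "bessel ip \<phi> \<sigma>" and c: "(\<lambda>i. (norm (c i))\<^sup>2) summable_on \<sigma>"
  shows "(\<lambda>i. scl (c i) (\<phi> i)) summable_on \<sigma>"
proof -
  obtain B where B: "0 \<le> B" "\<And>x. energy \<phi> \<sigma> x \<le> B * (norm x)\<^sup>2"
    using bessel_bound[OF bes] by blast
  show ?thesis
    using c _ B(1) norm_synthesis_finite[OF bes B] by (rule summable_on_if_norm_sum_le) simp
qed

lemma norm_synthesis_le:
  assumes bes: "bessel ip \<phi> \<sigma>" and B: "0 \<le> B" "\<And>x. energy \<phi> \<sigma> x \<le> B * (norm x)\<^sup>2"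
    and c: "(\<lambda>i. (norm (c i))\<^sup>2) summable_on \<sigma>"
  shows "(norm (\<Sum>\<^sub>\<infinity>i\<in>\<sigma>. scl (c i) (\<phi> i)))\<^sup>2 \<le> B * (\<Sum>\<^sub>\<infinity>i\<in>\<sigma>. (norm (c i))\<^sup>2)"
proof -
  let ?K = "sqrt (B * (\<Sum>\<^sub>\<infinity>i\<in>\<sigma>. (norm (c i))\<^sup>2))"
  have nonneg: "0 \<le> B * (\<Sum>\<^sub>\<infinity>i\<in>\<sigma>. (norm (c i))\<^sup>2)"
    using B(1) by (intro mult_nonneg_nonneg infsum_nonneg) auto
  have "(\<Sum>\<^sub>\<infinity>i\<in>\<sigma>. scl (c i) (\<phi> i)) \<in> cball 0 ?K"
  proof (rule has_sum_in_closed)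
    show "((\<lambda>i. scl (c i) (\<phi> i)) has_sum (\<Sum>\<^sub>\<infinity>i\<in>\<sigma>. scl (c i) (\<phi> i))) \<sigma>"
      using synthesis_summable[OF bes c] by simp
    fix F assume F: "finite F" "F \<subseteq> \<sigma>"
    have "(norm (\<Sum>i\<in>F. scl (c i) (\<phi> i)))\<^sup>2 \<le> B * (\<Sum>i\<in>F. (norm (c i))\<^sup>2)"
      by (rule norm_synthesis_finite[OF bes B F])
    also have "\<dots> \<le> B * (\<Sum>\<^sub>\<infinity>i\<in>\<sigma>. (norm (c i))\<^sup>2)"
      using B(1) c F by (intro mult_left_mono finite_sum_le_infsum) auto
    finally show "(\<Sum>i\<in>F. scl (c i) (\<phi> i)) \<in> cball 0 ?K"
      by (simp add: real_le_rsqrt)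
  qed simp
  then have "norm (\<Sum>\<^sub>\<infinity>i\<in>\<sigma>. scl (c i) (\<phi> i)) \<le> ?K"
    by simp
  then have "(norm (\<Sum>\<^sub>\<infinity>i\<in>\<sigma>. scl (c i) (\<phi> i)))\<^sup>2 \<le> ?K\<^sup>2"
    by (intro power_mono) auto
  then show ?thesis
    using nonneg by simp
qed

lemma frame_op_has_sum:
  "bessel ip \<phi> \<sigma> \<Longrightarrow> ((\<lambda>i. scl (ip x (\<phi> i)) (\<phi> i)) has_sum frame_op \<phi> \<sigma> x) \<sigma>"
  unfolding frame_op_def by (simp add: synthesis_summable bessel_summable)

lemma frame_op_in_closed_span:
  "bessel ip \<phi> \<sigma> \<Longrightarrow> frame_op \<phi> \<sigma> x \<in> closed_span scl \<phi> \<sigma>"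
  by (rule has_sum_in_closed_span[OF frame_op_has_sum])

lemma frame_op_zero [simp]: "frame_op \<phi> \<sigma> 0 = 0"
  by (simp add: frame_op_def)

lemma frame_op_selfadjoint:
  assumes "bessel ip \<phi> \<sigma>"
  shows "ip (frame_op \<phi> \<sigma> x) y = ip x (frame_op \<phi> \<sigma> y)"
proof -
  have "((\<lambda>i. ip x (\<phi> i) * ip (\<phi> i) y) has_sum ip (frame_op \<phi> \<sigma> x) y) \<sigma>"
    using has_sum_bounded_linear[OF bounded_linear_ip_left frame_op_has_sum[OF assms, of x], of y]
    by (simp add: ip_scale_left)
  moreover have "((\<lambda>i. ip x (\<phi> i) * ip (\<phi> i) y) has_sum ip x (frame_op \<phi> \<sigma> y)) \<sigma>"
    using has_sum_bounded_linear[OF bounded_linear_ip_right frame_op_has_sum[OF assms, of y], of x]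
    by (simp add: ip_scale_right mult.commute flip: ip_conj)
  ultimately show ?thesis
    by (rule has_sum_unique)
qed

lemma ip_frame_op_self:
  assumes "bessel ip \<phi> \<sigma>"
  shows "ip (frame_op \<phi> \<sigma> x) x = of_real (energy \<phi> \<sigma> x)"
proof -
  have "((\<lambda>i. ip x (\<phi> i) * ip (\<phi> i) x) has_sum ip (frame_op \<phi> \<sigma> x) x) \<sigma>"
    using has_sum_bounded_linear[OF bounded_linear_ip_left frame_op_has_sum[OF assms, of x], of x]
    by (simp add: ip_scale_left)
  moreover have "ip x (\<phi> i) * ip (\<phi> i) x = of_real ((norm (ip x (\<phi> i)))\<^sup>2)" for i
    by (metis ip_conj mult_conjg)
  ultimately have "((\<lambda>i. of_real ((norm (ip x (\<phi> i)))\<^sup>2) :: 'k) has_sum ip (frame_op \<phi> \<sigma> x) x) \<sigma>"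
    by simp
  moreover have "((\<lambda>i. of_real ((norm (ip x (\<phi> i)))\<^sup>2) :: 'k) has_sum of_real (energy \<phi> \<sigma> x)) \<sigma>"
    by (rule has_sum_of_real[OF energy_has_sum[OF assms]])
  ultimately show ?thesis
    by (rule has_sum_unique)
qed

section \<open>Tight frames for the closed span\<close>

text \<open>
  Self-adjointness replaces a continuity argument: the vector \<open>S x - t x\<close> lies in the closed span and
  is orthogonal to all its generators.
\<close>
lemma frame_op_eq_on_closed_span:
  assumes bes: "bessel ip \<phi> \<sigma>"
    and eig: "\<And>k. k \<in> \<sigma> \<Longrightarrow> frame_op \<phi> \<sigma> (\<phi> k) = t *\<^sub>R \<phi> k"
    and x: "x \<in> closed_span scl \<phi> \<sigma>"
  shows "frame_op \<phi> \<sigma> x = t *\<^sub>R x"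
proof -
  let ?d = "frame_op \<phi> \<sigma> x - t *\<^sub>R x"
  have d: "?d \<in> closed_span scl \<phi> \<sigma>"
    using frame_op_in_closed_span[OF bes] scaleR_in_closed_span[OF x]
    by (rule subspace_diff[OF subspace_closed_span])
  have "ip ?d (\<phi> k) = 0" if "k \<in> \<sigma>" for k
    using eig[OF that]
    by (simp add: ip_diff_left ip_scaleR_left frame_op_selfadjoint[OF bes] ip_scaleR_right)
  then have "ip ?d ?d = 0"
    using d by (rule orthogonal_closed_span)
  then show ?thesis
    by simp
qed

text \<open>
  Tightness says that the self-adjoint operator \<open>S - A\<close> has vanishing quadratic form on the closed
  span, and that subspace is invariant; such an operator is zero there.
\<close>
lemma tight_frame_bounds_iff:
  assumes bes: "bessel ip \<phi> \<sigma>"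
  shows "frame_bounds ip \<phi> \<sigma> (closed_span scl \<phi> \<sigma>) A A \<longleftrightarrow>
    0 < A \<and> (\<forall>x\<in>closed_span scl \<phi> \<sigma>. frame_op \<phi> \<sigma> x = A *\<^sub>R x)" (is "?L \<longleftrightarrow> ?R")
proof -
  let ?V = "closed_span scl \<phi> \<sigma>"
  have L: "?L \<longleftrightarrow> 0 < A \<and> (\<forall>x\<in>?V. energy \<phi> \<sigma> x = A * (norm x)\<^sup>2)"
    using in_closed_span[of _ \<sigma> \<phi>] bessel_summable[OF bes]
    unfolding frame_bounds_def energy_def by (auto simp: order_eq_iff)
  show ?thesis
  proof
    assume ?L
    then have A: "0 < A" and en: "\<And>x. x \<in> ?V \<Longrightarrow> energy \<phi> \<sigma> x = A * (norm x)\<^sup>2"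
      by (auto simp: L)
    define T where "T x = frame_op \<phi> \<sigma> x - A *\<^sub>R x" for x
    have T_in: "T x \<in> ?V" if "x \<in> ?V" for x
      unfolding T_def using frame_op_in_closed_span[OF bes] scaleR_in_closed_span[OF that]
      by (rule subspace_diff[OF subspace_closed_span])
    have T_self: "ip (T x) y = ip x (T y)" for x y
      by (simp add: T_def ip_diff_left ip_diff_right ip_scaleR_left ip_scaleR_right frame_op_selfadjoint[OF bes])
    have T_form: "ip (T x) x = 0" if "x \<in> ?V" for x
      using en[OF that] by (simp add: T_def ip_diff_left ip_scaleR_left ip_self ip_frame_op_self[OF bes])
    have "T x = 0" if x: "x \<in> ?V" for x
    proof -
      (* polarization with the vector T x gives 2 * norm (T x)^2 = 0 *)
      have "x + T x \<in> ?V"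
        using subspace_add[OF subspace_closed_span x T_in[OF x]] .
      then have "0 = ip (T (x + T x)) (x + T x)"
        by (simp add: T_form)
      also have "\<dots> = ip (x + T x) (T x) + ip (x + T x) (T (T x))"
        by (simp add: ip_add_right T_self[of "x + T x"])
      also have "\<dots> = ip (T x) x + ip (T x) (T x) + (ip (T x) (T x) + ip (T (T x)) (T x))"
        by (simp add: ip_add_left T_self)
      also have "\<dots> = 2 * ip (T x) (T x)"
        using T_form[OF x] T_form[OF T_in[OF x]] by simp
      finally show ?thesis
        by simp
    qed
    with A show ?R
      by (simp add: T_def)
  next
    assume R: ?R
    have "energy \<phi> \<sigma> x = A * (norm x)\<^sup>2" if "x \<in> ?V" for x
    proof -
      have "(of_real (energy \<phi> \<sigma> x) :: 'k) = of_real (A * (norm x)\<^sup>2)"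
        unfolding ip_frame_op_self[OF bes, symmetric] using R that by (simp add: ip_scaleR_left ip_self)
      then show ?thesis
        unfolding of_real_eq_iff .
    qed
    with R show ?L
      by (simp add: L)
  qed
qed

text \<open>
  Up to the factor \<open>A\<close>, the frame operator of a tight frame is the orthogonal projection onto the
  closed span: \<open>S\<^sup>2 = A S\<close> holds on the whole space, because the range of \<open>S\<close> lies in the closed span.
  Taking inner products with \<open>x\<close> turns this into the identity below.
\<close>
lemma tight_frame_op_norm_square:
  assumes bes: "bessel ip \<phi> \<sigma>" and tight: "frame_bounds ip \<phi> \<sigma> (closed_span scl \<phi> \<sigma>) A A"
  shows "(norm (frame_op \<phi> \<sigma> x))\<^sup>2 = A * energy \<phi> \<sigma> x"
proof -
  let ?S = "frame_op \<phi> \<sigma>"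
  have "ip (?S x) (?S x) = ip (?S (?S x)) x"
    by (simp add: frame_op_selfadjoint[OF bes])
  also have "?S (?S x) = A *\<^sub>R ?S x"
    using tight frame_op_in_closed_span[OF bes] by (simp add: tight_frame_bounds_iff[OF bes])
  also have "ip (A *\<^sub>R ?S x) x = of_real (A * energy \<phi> \<sigma> x)"
    by (simp add: ip_scaleR_left ip_frame_op_self[OF bes])
  finally show ?thesis
    unfolding ip_self of_real_eq_iff .
qed

text \<open>A bound on the closed span extends to the whole space, since the projection is a contraction.\<close>
lemma tight_energy_le:
  assumes bes: "bessel ip \<phi> \<sigma>" and tight: "frame_bounds ip \<phi> \<sigma> (closed_span scl \<phi> \<sigma>) A A"
  shows "energy \<phi> \<sigma> x \<le> A * (norm x)\<^sup>2"
proof -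
  have A: "A > 0"
    using tight by (simp add: frame_bounds_def)
  have "energy \<phi> \<sigma> x = norm (ip (frame_op \<phi> \<sigma> x) x)"
    using energy_nonneg by (simp add: ip_frame_op_self[OF bes])
  also have "\<dots> \<le> norm (frame_op \<phi> \<sigma> x) * norm x"
    by (rule Cauchy_Schwarz)
  finally have "(energy \<phi> \<sigma> x)\<^sup>2 \<le> (norm (frame_op \<phi> \<sigma> x) * norm x)\<^sup>2"
    using energy_nonneg by (rule power_mono)
  also have "\<dots> = (A * (norm x)\<^sup>2) * energy \<phi> \<sigma> x"
    by (simp add: power_mult_distrib tight_frame_op_norm_square[OF assms])
  finally show ?thesis
    by (rule norm_le_of_square_le_mult) (use energy_nonneg A in auto)
qed

text \<open>
  The synthesis bound costs a factor \<open>A\<close> in the squared norm, and for the frame operator itself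
  this bound is an equality.
\<close>
lemma tight_multiplier_norm_le:
  fixes a :: "nat \<Rightarrow> real"
  assumes bes: "bessel ip \<phi> \<sigma>" and tight: "frame_bounds ip \<phi> \<sigma> (closed_span scl \<phi> \<sigma>) A A"
    and a: "\<And>i. i \<in> \<sigma> \<Longrightarrow> \<bar>a i\<bar> \<le> 1"
  shows "(norm (\<Sum>\<^sub>\<infinity>i\<in>\<sigma>. scl (of_real (a i) * ip x (\<phi> i)) (\<phi> i)))\<^sup>2 \<le> (norm (frame_op \<phi> \<sigma> x))\<^sup>2"
proof -
  have A: "A > 0"
    using tight by (simp add: frame_bounds_def)
  have le: "(norm (of_real (a i) * ip x (\<phi> i)))\<^sup>2 \<le> (norm (ip x (\<phi> i)))\<^sup>2" if "i \<in> \<sigma>" for i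
    using a[OF that] by (intro power_mono) (auto simp: norm_mult mult_left_le_one_le)
  have summ: "(\<lambda>i. (norm (of_real (a i) * ip x (\<phi> i)))\<^sup>2) summable_on \<sigma>"
    by (rule summable_on_comparison_test[OF bessel_summable[OF bes] le]) auto
  have "(norm (\<Sum>\<^sub>\<infinity>i\<in>\<sigma>. scl (of_real (a i) * ip x (\<phi> i)) (\<phi> i)))\<^sup>2
      \<le> A * (\<Sum>\<^sub>\<infinity>i\<in>\<sigma>. (norm (of_real (a i) * ip x (\<phi> i)))\<^sup>2)"
    using A by (intro norm_synthesis_le[OF bes _ _ summ] tight_energy_le[OF bes tight]) auto
  also have "\<dots> \<le> A * energy \<phi> \<sigma> x"
    unfolding energy_def using A summ le bessel_summable[OF bes]
    by (intro mult_left_mono infsum_mono) auto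
  finally show ?thesis
    by (simp add: tight_frame_op_norm_square[OF bes tight])
qed

end

section \<open>Eigenvectors of the frame operator\<close>

context hilbert_space
begin

text \<open>
  The operator \<open>e \<langle>\<cdot>, f\<rangle> f\<close> may be subtracted from \<open>S\<close> without increasing norms only if \<open>f\<close> is an
  eigenvector. Otherwise \<open>S f\<close> has a component \<open>u \<noteq> 0\<close> orthogonal to \<open>f\<close>. Moving from \<open>f\<close> along \<open>u\<close> to
  some \<open>x\<close> keeps \<open>\<langle>x, f\<rangle>\<close> and makes \<open>\<langle>S x, f\<rangle> = \<langle>x, S f\<rangle>\<close> vanish; then subtracting a nonzero multiple of
  \<open>f\<close> from \<open>S x\<close> strictly increases the norm. The eigenvalue is read off by pairing with \<open>f\<close>; for
  \<open>f = 0\<close> the quotient has the value \<open>0\<close>.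
\<close>
lemma eigenvector_of_frame_op:
  assumes bes: "bessel ip \<phi> I" and e: "0 < e"
    and contr: "\<And>x. norm (frame_op \<phi> I x - e *\<^sub>R scl (ip x f) f) \<le> norm (frame_op \<phi> I x)"
  shows "frame_op \<phi> I f = (energy \<phi> I f / (norm f)\<^sup>2) *\<^sub>R f"
proof (cases "f = 0")
  case False
  let ?S = "frame_op \<phi> I"
  define n where "n = (norm f)\<^sup>2"
  define q where "q = energy \<phi> I f"
  define u where "u = ?S f - (q / n) *\<^sub>R f"
  have n: "n > 0"
    using False by (simp add: n_def)
  have ff: "ip f f = of_real n"
    by (simp add: ip_self n_def)
  have Sff: "ip (?S f) f = of_real q"
    by (simp add: ip_frame_op_self[OF bes] q_def)
  have fSf: "ip f (?S f) = of_real q"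
    using Sff by (simp add: frame_op_selfadjoint[OF bes])
  have uf: "ip u f = 0"
    using n by (simp add: u_def ip_diff_left ip_scaleR_left Sff ff)
  have "ip u (?S f) = ip u (u + (q / n) *\<^sub>R f)"
    by (simp add: u_def)
  then have uS: "ip u (?S f) = of_real ((norm u)\<^sup>2)"
    by (simp only: ip_add_right ip_scaleR_right uf ip_self) simp
  have "u = 0"
  proof (rule ccontr)
    assume "u \<noteq> 0"
    then have nu: "(norm u)\<^sup>2 \<noteq> 0"
      by simp
    define s where "s = - q / (norm u)\<^sup>2"
    define x where "x = f + s *\<^sub>R u"
    have xf: "ip x f = of_real n"
      by (simp add: x_def ip_add_left ip_scaleR_left ff uf)
    have "ip (?S x) f = of_real (q + s * (norm u)\<^sup>2)"
      by (simp add: frame_op_selfadjoint[OF bes] x_def ip_add_left ip_scaleR_left fSf uS)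
    also have "q + s * (norm u)\<^sup>2 = 0"
      using nu by (simp add: s_def)
    finally have Sx: "ip (?S x) f = of_real 0" .
    have "(norm (?S x - (e * n) *\<^sub>R f))\<^sup>2 \<le> (norm (?S x))\<^sup>2"
      using contr[of x] by (intro power_mono) (simp_all add: xf scale_of_real)
    then have "(e * n)\<^sup>2 * n \<le> 0"
      by (simp add: norm_diff_scaleR_square[OF Sx] n_def)
    moreover have "(e * n)\<^sup>2 * n > 0"
      using e n by simp
    ultimately show False
      by simp
  qed
  then show ?thesis
    by (simp add: u_def q_def n_def)
qed simp

lemma multiplier_one_point:
  assumes bes: "bessel ip \<phi> I" and k: "k \<in> I"
  shows "(\<Sum>\<^sub>\<infinity>i\<in>I. scl (of_real (if i = k then 1 - e else 1) * ip x (\<phi> i)) (\<phi> i))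
    = frame_op \<phi> I x - e *\<^sub>R scl (ip x (\<phi> k)) (\<phi> k)"
proof (rule infsumI)
  let ?p = "- e *\<^sub>R scl (ip x (\<phi> k)) (\<phi> k)"
  have "((\<lambda>i. if i = k then ?p else 0) has_sum ?p) I"
    using k by (intro has_sum_finite_neutralI[of "{k}"]) auto
  from has_sum_add[OF frame_op_has_sum[OF bes, of x] this]
  show "((\<lambda>i. scl (of_real (if i = k then 1 - e else 1) * ip x (\<phi> i)) (\<phi> i)) has_sum
      frame_op \<phi> I x - e *\<^sub>R scl (ip x (\<phi> k)) (\<phi> k)) I"
    unfolding diff_conv_add_uminus scaleR_minus_left[symmetric]
    by (rule has_sum_cong[THEN iffD1, rotated])
       (auto simp: scale_left_diff_distrib left_diff_distrib simp flip: scale_of_real)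
qed

text \<open>
  The cells are the sets of indices that share an eigenvalue. Zero vectors form the cell of the
  eigenvalue \<open>0\<close>, which is a tight frame for the zero space with any bound.
\<close>
lemma eigenvectors_imp_orthogonal_tight_partition:
  assumes bes: "bessel ip \<phi> I"
    and eig: "\<And>k. k \<in> I \<Longrightarrow> frame_op \<phi> I (\<phi> k) = (energy \<phi> I (\<phi> k) / (norm (\<phi> k))\<^sup>2) *\<^sub>R \<phi> k"
  shows "\<exists>P. orthogonal_tight_partition scl ip \<phi> I P"
proof -
  define ev where "ev k = energy \<phi> I (\<phi> k) / (norm (\<phi> k))\<^sup>2" for k
  define cell where "cell t = {i \<in> I. ev i = t}" for t
  have orth: "ip (\<phi> k) (\<phi> l) = 0" if "k \<in> I" "l \<in> I" "ev k \<noteq> ev l" for k l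
  proof -
    have "of_real (ev k) * ip (\<phi> k) (\<phi> l) = of_real (ev l) * ip (\<phi> k) (\<phi> l)"
      using frame_op_selfadjoint[OF bes, of "\<phi> k" "\<phi> l"] that(1,2)
      by (simp add: eig ip_scaleR_left ip_scaleR_right flip: ev_def)
    with that(3) show ?thesis
      by simp
  qed
  have "tight_frame_for ip \<phi> (cell t) (closed_span scl \<phi> (cell t))" if "t \<in> ev ` I" for t
  proof -
    have cell_bes: "bessel ip \<phi> (cell t)"
      using bes by (rule bessel_subset) (auto simp: cell_def)
    have eig_cell: "frame_op \<phi> (cell t) (\<phi> k) = t *\<^sub>R \<phi> k" if "k \<in> cell t" for k
    proof -
      (* all terms outside the cell vanish by orthogonality *)
      have "frame_op \<phi> (cell t) (\<phi> k) = frame_op \<phi> I (\<phi> k)"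
        unfolding frame_op_def
        by (rule infsum_cong_neutral) (use that orth in \<open>auto simp: cell_def\<close>)
      with that show ?thesis
        using eig[of k] by (auto simp: cell_def ev_def)
    qed
    have on_span: "frame_op \<phi> (cell t) x = t *\<^sub>R x" if "x \<in> closed_span scl \<phi> (cell t)" for x
      by (rule frame_op_eq_on_closed_span[OF cell_bes eig_cell that])
    show ?thesis
    proof (cases "t > 0")
      case True
      then show ?thesis
        unfolding tight_frame_for_def tight_frame_bounds_iff[OF cell_bes] using on_span by blast
    next
      case False
      have zero: "\<phi> k = 0" if "k \<in> cell t" for k
      proof (rule ccontr)
        assume "\<phi> k \<noteq> 0"
        then have "0 < (norm (ip (\<phi> k) (\<phi> k)))\<^sup>2"
          by simp
        also have "\<dots> \<le> energy \<phi> I (\<phi> k)"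
          using energy_ge_term[OF bes] that by (simp add: cell_def)
        finally have "ev k > 0"
          unfolding ev_def using \<open>\<phi> k \<noteq> 0\<close> by simp
        with that False show False
          by (simp add: cell_def)
      qed
      have "frame_op \<phi> (cell t) x = 1 *\<^sub>R x" if "x \<in> closed_span scl \<phi> (cell t)" for x
      proof -
        have "x = 0"
          using orthogonal_closed_span[of "cell t" x \<phi> x] that zero by simp
        then show ?thesis
          by simp
      qed
      then show ?thesis
        unfolding tight_frame_for_def tight_frame_bounds_iff[OF cell_bes]
        by (intro exI[of _ 1] conjI zero_less_one ballI)
    qed
  qed
  then have "\<forall>\<mu>\<in>cell ` ev ` I. tight_frame_for ip \<phi> \<mu> (closed_span scl \<phi> \<mu>)"
    by blast
  moreover have "partition_on I (cell ` ev ` I)"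
    by (auto simp: partition_on_def disjoint_def cell_def)
  moreover have "ip (\<phi> k) (\<phi> l) = 0"
    if "\<mu> \<in> cell ` ev ` I" "\<nu> \<in> cell ` ev ` I" "\<mu> \<noteq> \<nu>" "k \<in> \<mu>" "l \<in> \<nu>" for \<mu> \<nu> k l
    using that by (intro orth) (auto simp: cell_def)
  ultimately have "orthogonal_tight_partition scl ip \<phi> I (cell ` ev ` I)"
    unfolding orthogonal_tight_partition_def by blast
  then show ?thesis ..
qed

section \<open>Orthogonal partitions into tight frames\<close>

lemma orthogonal_tight_partition_subset:
  "orthogonal_tight_partition scl ip \<phi> I P \<Longrightarrow> \<mu> \<in> P \<Longrightarrow> \<mu> \<subseteq> I"
  by (auto simp: orthogonal_tight_partition_def partition_on_def)

lemma orthogonal_tight_partition_orthogonal: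
  assumes "orthogonal_tight_partition scl ip \<phi> I P" "\<mu> \<in> P" "\<nu> \<in> P" "\<mu> \<noteq> \<nu>"
    and "x \<in> closed_span scl \<phi> \<mu>" "y \<in> closed_span scl \<phi> \<nu>"
  shows "ip x y = 0"
  using assms(1-4) by (intro orthogonal_closed_spans[OF _ assms(5,6)]) (auto simp: orthogonal_tight_partition_def)

text \<open>
  The partial sums over different cells lie in orthogonal subspaces, so the squared norms add up
  and the inequality may be checked in each cell.
\<close>
lemma orthogonal_tight_partition_multiplier_le:
  fixes a :: "nat \<Rightarrow> real"
  assumes bes: "bessel ip \<phi> I" and P: "orthogonal_tight_partition scl ip \<phi> I P"
    and a: "\<And>i. i \<in> I \<Longrightarrow> \<bar>a i\<bar> \<le> 1"
  shows "norm (\<Sum>\<^sub>\<infinity>i\<in>I. scl (of_real (a i) * ip x (\<phi> i)) (\<phi> i)) \<le> norm (frame_op \<phi> I x)"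
proof -
  define mult where "mult b \<sigma> = (\<Sum>\<^sub>\<infinity>i\<in>\<sigma>. scl (of_real (b i) * ip x (\<phi> i)) (\<phi> i))"
    for b :: "nat \<Rightarrow> real" and \<sigma>
  have part: "partition_on I P"
    using P by (simp add: orthogonal_tight_partition_def)
  (* this is used both for b = a and for the constant multiplier 1 *)
  have squares: "((\<lambda>\<mu>. (norm (mult b \<mu>))\<^sup>2) has_sum (norm (mult b I))\<^sup>2) P"
    if b: "\<And>i. i \<in> I \<Longrightarrow> \<bar>b i\<bar> \<le> 1" for b
  proof -
    have "(\<lambda>i. (norm (of_real (b i) * ip x (\<phi> i)))\<^sup>2) summable_on I"
      using b by (intro summable_on_comparison_test[OF bessel_summable[OF bes, of x]] power_mono)
        (auto simp: norm_mult mult_left_le_one_le)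
    then have summ: "(\<lambda>i. scl (of_real (b i) * ip x (\<phi> i)) (\<phi> i)) summable_on I"
      by (rule synthesis_summable[OF bes])
    have mult_in: "mult b \<mu> \<in> closed_span scl \<phi> \<mu>" if "\<mu> \<in> P" for \<mu>
      unfolding mult_def
      using has_sum_infsum[OF summable_on_subset_banach[OF summ orthogonal_tight_partition_subset[OF P that]]]
      by (rule has_sum_in_closed_span)
    have "(mult b has_sum mult b I) P"
      unfolding mult_def by (rule has_sum_partition[OF part summ])
    then show ?thesis
      using mult_in orthogonal_tight_partition_orthogonal[OF P]
      by (intro has_sum_norm_square_orthogonal) blast+
  qed
  have one: "mult (\<lambda>i. 1) \<sigma> = frame_op \<phi> \<sigma> x" for \<sigma>
    by (simp add: mult_def frame_op_def)
  have "(norm (mult a I))\<^sup>2 \<le> (norm (mult (\<lambda>i. 1) I))\<^sup>2"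
  proof (rule has_sum_mono[OF squares[of a, OF a] squares[of "\<lambda>i. 1"]])
    fix \<mu> assume \<mu>: "\<mu> \<in> P"
    note sub = orthogonal_tight_partition_subset[OF P \<mu>]
    obtain A where "frame_bounds ip \<phi> \<mu> (closed_span scl \<phi> \<mu>) A A"
      using P \<mu> by (auto simp: orthogonal_tight_partition_def tight_frame_for_def)
    then show "(norm (mult a \<mu>))\<^sup>2 \<le> (norm (mult (\<lambda>i. 1) \<mu>))\<^sup>2"
      unfolding one unfolding mult_def
      by (rule tight_multiplier_norm_le[OF bessel_subset[OF bes sub]]) (use sub a in auto)
  qed auto
  then show ?thesis
    unfolding one unfolding mult_def by simp
qed

text \<open>
  The vectors \<open>f x \<mu>\<close> are the orthogonal projections of \<open>x\<close> to the closed spans of the cells. Their sum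
  converges by Bessel's inequality. It equals \<open>x\<close> because it has the same inner products as \<open>x\<close> with
  the whole family, which spans.
\<close>
lemma tight_components:
  assumes bes: "bessel ip \<phi> I" and span: "closed_span scl \<phi> I = UNIV"
    and P: "orthogonal_tight_partition scl ip \<phi> I P"
    and tight: "\<forall>\<mu>\<in>P. frame_bounds ip \<phi> \<mu> (closed_span scl \<phi> \<mu>) (A \<mu>) (A \<mu>)"
  defines "f x \<mu> \<equiv> inverse (A \<mu>) *\<^sub>R frame_op \<phi> \<mu> x"
  shows "\<And>x \<mu>. \<mu> \<in> P \<Longrightarrow> f x \<mu> \<in> closed_span scl \<phi> \<mu>"
    and "\<And>x \<mu>. \<mu> \<in> P \<Longrightarrow> energy \<phi> \<mu> x = A \<mu> * (norm (f x \<mu>))\<^sup>2"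
    and "\<And>x. (f x has_sum x) P"
    and "\<And>x. ((\<lambda>\<mu>. (norm (f x \<mu>))\<^sup>2) has_sum (norm x)\<^sup>2) P"
proof -
  have part: "partition_on I P"
    using P by (simp add: orthogonal_tight_partition_def)
  note A = bspec[OF tight]
  have bes_cell: "bessel ip \<phi> \<mu>" if "\<mu> \<in> P" for \<mu>
    using bes orthogonal_tight_partition_subset[OF P that] by (rule bessel_subset)
  have Apos: "A \<mu> > 0" if "\<mu> \<in> P" for \<mu>
    using A[OF that] by (simp add: frame_bounds_def)
  show f_in: "f x \<mu> \<in> closed_span scl \<phi> \<mu>" if "\<mu> \<in> P" for x \<mu>
    unfolding f_def by (rule scaleR_in_closed_span[OF frame_op_in_closed_span[OF bes_cell[OF that]]])
  have f_orth: "ip (f x \<mu>) (f y \<nu>) = 0" if "\<mu> \<in> P" "\<nu> \<in> P" "\<mu> \<noteq> \<nu>" for x y \<mu> \<nu>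
    using orthogonal_tight_partition_orthogonal[OF P that f_in f_in] that by simp
  show en: "energy \<phi> \<mu> x = A \<mu> * (norm (f x \<mu>))\<^sup>2" if "\<mu> \<in> P" for x \<mu>
    using tight_frame_op_norm_square[OF bes_cell[OF that] A[OF that], of x] Apos[OF that]
    by (simp add: f_def power_mult_distrib) (simp add: power2_eq_square field_simps)
  have ip_f: "ip (f x \<mu>) x = of_real ((norm (f x \<mu>))\<^sup>2)" if "\<mu> \<in> P" for x \<mu>
  proof -
    have "ip (f x \<mu>) x = of_real (inverse (A \<mu>) * energy \<phi> \<mu> x)"
      by (simp add: f_def ip_scaleR_left ip_frame_op_self[OF bes_cell[OF that]])
    also have "inverse (A \<mu>) * energy \<phi> \<mu> x = (norm (f x \<mu>))\<^sup>2"
      using Apos[OF that] by (simp add: en[OF that])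
    finally show ?thesis .
  qed
  (* Bessel's inequality: y below satisfies ip y x = norm y ^ 2, hence norm y \<le> norm x *)
  have sum_le: "(\<Sum>\<mu>\<in>F. (norm (f x \<mu>))\<^sup>2) \<le> (norm x)\<^sup>2" if F: "finite F" "F \<subseteq> P" for x F
  proof -
    define y where "y = sum (f x) F"
    have y: "(norm y)\<^sup>2 = (\<Sum>\<mu>\<in>F. (norm (f x \<mu>))\<^sup>2)"
      unfolding y_def using F f_orth by (intro norm_sum_orthogonal_square) blast+
    have "ip y x = (\<Sum>\<mu>\<in>F. of_real ((norm (f x \<mu>))\<^sup>2))"
      unfolding y_def ip_sum_left by (rule sum.cong) (use F ip_f in auto)
    also have "\<dots> = of_real ((norm y)\<^sup>2)"
      by (simp only: y of_real_sum)
    finally have "(norm y)\<^sup>2 \<le> norm x * norm y"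
      using Cauchy_Schwarz[of y x] by (simp add: norm_power mult.commute)
    then have "norm y \<le> norm x"
      by (rule norm_le_of_square_le_mult) auto
    then show ?thesis
      unfolding y[symmetric] by (rule power_mono) simp
  qed
  show has: "(f x has_sum x) P" for x
  proof -
    have squares: "(\<lambda>\<mu>. (norm (f x \<mu>))\<^sup>2) summable_on P"
      using sum_le by (intro nonneg_bdd_above_summable_on bdd_aboveI2) auto
    have "f x summable_on P"
    proof (rule summable_on_if_norm_sum_le[OF squares])
      fix F assume "finite F" "F \<subseteq> P"
      then show "(norm (sum (f x) F))\<^sup>2 \<le> 1 * (\<Sum>\<mu>\<in>F. (norm (f x \<mu>))\<^sup>2)"
        using norm_sum_orthogonal_square[of F "f x"] f_orth by (simp add: subset_iff)
    qed auto
    then obtain y where y: "(f x has_sum y) P"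
      by (auto simp: summable_on_def)
    have "ip (y - x) (\<phi> k) = 0" if "k \<in> I" for k
    proof -
      obtain \<mu> where \<mu>: "\<mu> \<in> P" "k \<in> \<mu>"
        using partition_onD1[OF part] \<open>k \<in> I\<close> by blast
      have "ip (f x \<mu>) (\<phi> k) = ip x (inverse (A \<mu>) *\<^sub>R frame_op \<phi> \<mu> (\<phi> k))"
        by (simp add: f_def ip_scaleR_left ip_scaleR_right frame_op_selfadjoint[OF bes_cell[OF \<mu>(1)]])
      also have "frame_op \<phi> \<mu> (\<phi> k) = A \<mu> *\<^sub>R \<phi> k"
        using A[OF \<mu>(1)] in_closed_span[OF \<mu>(2)] by (simp add: tight_frame_bounds_iff[OF bes_cell[OF \<mu>(1)]])
      finally have own: "ip (f x \<mu>) (\<phi> k) = ip x (\<phi> k)"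
        using Apos[OF \<mu>(1)] by simp
      have other: "ip (f x \<nu>) (\<phi> k) = 0" if "\<nu> \<in> P - {\<mu>}" for \<nu>
        using that \<mu> by (intro orthogonal_tight_partition_orthogonal[OF P _ \<mu>(1) _ f_in in_closed_span]) auto
      from y have "((\<lambda>\<nu>. ip (f x \<nu>) (\<phi> k)) has_sum ip y (\<phi> k)) P"
        by (rule has_sum_bounded_linear[OF bounded_linear_ip_left])
      moreover have "((\<lambda>\<nu>. ip (f x \<nu>) (\<phi> k)) has_sum ip x (\<phi> k)) P"
        using \<mu>(1) own other by (intro has_sum_finite_neutralI[of "{\<mu>}"]) auto
      ultimately have "ip y (\<phi> k) = ip x (\<phi> k)"
        by (rule has_sum_unique)
      then show ?thesis
        by (simp add: ip_diff_left)
    qed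
    moreover have "y - x \<in> closed_span scl \<phi> I"
      unfolding span by (rule UNIV_I)
    ultimately have "ip (y - x) (y - x) = 0"
      by (rule orthogonal_closed_span)
    with y show ?thesis
      by simp
  qed
  show "((\<lambda>\<mu>. (norm (f x \<mu>))\<^sup>2) has_sum (norm x)\<^sup>2) P" for x
    using has f_orth by (rule has_sum_norm_square_orthogonal)
qed

lemma orthogonal_tight_partition_iff_direct_sum:
  assumes bes: "bessel ip \<phi> I" and span: "closed_span scl \<phi> I = UNIV"
  shows "orthogonal_tight_partition scl ip \<phi> I P \<longleftrightarrow>
    partition_on I P \<and> hilbert_direct_sum scl ip (closed_span scl \<phi>) P \<and>
    (\<forall>\<mu>\<in>P. tight_frame_for ip \<phi> \<mu> (closed_span scl \<phi> \<mu>))" (is "?L \<longleftrightarrow> ?R")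
proof
  assume P: ?L
  then obtain A where A: "\<forall>\<mu>\<in>P. frame_bounds ip \<phi> \<mu> (closed_span scl \<phi> \<mu>) (A \<mu>) (A \<mu>)"
    unfolding orthogonal_tight_partition_def tight_frame_for_def by metis
  note comp = tight_components[OF bes span P A]
  have "\<exists>f. (\<forall>\<mu>\<in>P. f \<mu> \<in> closed_span scl \<phi> \<mu>) \<and> (\<lambda>\<mu>. (norm (f \<mu>))\<^sup>2) summable_on P \<and> (f has_sum x) P" for x
    by (rule exI[of _ "\<lambda>\<mu>. inverse (A \<mu>) *\<^sub>R frame_op \<phi> \<mu> x"])
       (intro conjI ballI comp(1) comp(3) has_sum_imp_summable[OF comp(4)])
  then have "hilbert_direct_sum scl ip (closed_span scl \<phi>) P"
    unfolding hilbert_direct_sum_def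
    by (simp add: subspace_closed_span closed_closed_span orthogonal_tight_partition_orthogonal[OF P])
  with P show ?R
    by (simp add: orthogonal_tight_partition_def)
next
  assume R: ?R
  have "ip (\<phi> k) (\<phi> l) = 0" if "\<mu> \<in> P" "\<nu> \<in> P" "\<mu> \<noteq> \<nu>" "k \<in> \<mu>" "l \<in> \<nu>" for \<mu> \<nu> k l
    using R that in_closed_span[of k \<mu> \<phi>] in_closed_span[of l \<nu> \<phi>] unfolding hilbert_direct_sum_def by blast
  with R show ?L
    unfolding orthogonal_tight_partition_def by blast
qed

text \<open>
  A lower frame bound \<open>c\<close> of the whole family can be tested on a nonzero vector of one cell, which sees
  only that cell; thus \<open>c\<close> is at most the tight frame bound. Conversely, if \<open>c > 0\<close> lies strictly below
  the infimum, each cell has a tight frame bound above \<open>c\<close>, and summing over the components of \<open>x\<close> shows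
  that \<open>c\<close> is a lower frame bound.
\<close>
lemma frame_for_UNIV_iff_INF_tight_bounds:
  assumes bes: "bessel ip \<phi> I" and span: "closed_span scl \<phi> I = UNIV"
    and P: "orthogonal_tight_partition scl ip \<phi> I P"
  shows "frame_for ip \<phi> I UNIV \<longleftrightarrow>
    (INF \<mu>\<in>P. tight_frame_bound ip \<phi> \<mu> (closed_span scl \<phi> \<mu>)) \<noteq> 0" (is "_ \<longleftrightarrow> ?inf \<noteq> 0")
proof
  assume "frame_for ip \<phi> I UNIV"
  then obtain c where c: "c > 0" "\<And>x. c * (norm x)\<^sup>2 \<le> energy \<phi> I x"
    by (auto simp: frame_for_def frame_bounds_def energy_def)
  have "ereal c \<le> tight_frame_bound ip \<phi> \<mu> (closed_span scl \<phi> \<mu>)" if \<mu>: "\<mu> \<in> P" for \<mu>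
  proof -
    let ?V = "closed_span scl \<phi> \<mu>"
    have bes_cell: "bessel ip \<phi> \<mu>"
      using bes orthogonal_tight_partition_subset[OF P \<mu>] by (rule bessel_subset)
    obtain A where A: "frame_bounds ip \<phi> \<mu> ?V A A"
      using P \<mu> by (auto simp: orthogonal_tight_partition_def tight_frame_for_def)
    have "\<exists>B\<ge>c. frame_bounds ip \<phi> \<mu> ?V B B"
    proof (cases "\<exists>x\<in>?V. x \<noteq> 0")
      case True
      then obtain x where x: "x \<in> ?V" "x \<noteq> 0"
        by blast
      have "ip x (\<phi> i) = 0" if "i \<in> I - \<mu>" for i
      proof -
        obtain \<nu> where "\<nu> \<in> P" "i \<in> \<nu>"
          using P \<open>i \<in> I - \<mu>\<close> by (auto simp: orthogonal_tight_partition_def partition_on_def)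
        then show ?thesis
          using \<open>i \<in> I - \<mu>\<close> by (intro orthogonal_tight_partition_orthogonal[OF P \<mu> _ _ x(1) in_closed_span]) auto
      qed
      then have "energy \<phi> I x = energy \<phi> \<mu> x"
        unfolding energy_def using orthogonal_tight_partition_subset[OF P \<mu>]
        by (intro infsum_cong_neutral) auto
      also have "\<dots> \<le> A * (norm x)\<^sup>2"
        by (rule tight_energy_le[OF bes_cell A])
      finally have "c * (norm x)\<^sup>2 \<le> A * (norm x)\<^sup>2"
        using c(2)[of x] by simp
      then have "c \<le> A"
        using x(2) by simp
      with A show ?thesis
        by blast
    next
      case False
      (* the closed span is {0}, so that every positive number is a tight frame bound *)
      then have "frame_bounds ip \<phi> \<mu> ?V c c"
        using c(1) by (auto simp: tight_frame_bounds_iff[OF bes_cell])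
      then show ?thesis
        by blast
    qed
    then obtain B where "c \<le> B" "frame_bounds ip \<phi> \<mu> ?V B B"
      by blast
    then show ?thesis
      unfolding tight_frame_bound_def by (intro Sup_upper2[of "ereal B"]) auto
  qed
  then have "ereal c \<le> ?inf"
    by (rule INF_greatest)
  with c(1) show "?inf \<noteq> 0"
    by (auto simp: zero_ereal_def)
next
  assume "?inf \<noteq> 0"
  moreover have "0 \<le> tight_frame_bound ip \<phi> \<mu> (closed_span scl \<phi> \<mu>)" if \<mu>: "\<mu> \<in> P" for \<mu>
  proof -
    obtain A where "frame_bounds ip \<phi> \<mu> (closed_span scl \<phi> \<mu>) A A"
      using P \<mu> by (auto simp: orthogonal_tight_partition_def tight_frame_for_def)
    then show ?thesis
      unfolding tight_frame_bound_def by (intro Sup_upper2[of "ereal A"]) (auto simp: frame_bounds_def)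
  qed
  then have "0 \<le> ?inf"
    by (rule INF_greatest)
  ultimately have "0 < ?inf"
    by simp
  then obtain c where c: "0 < ereal c" "ereal c < ?inf"
    using ereal_dense2 by blast
  have "\<exists>A>c. frame_bounds ip \<phi> \<mu> (closed_span scl \<phi> \<mu>) A A" if "\<mu> \<in> P" for \<mu>
  proof -
    have "ereal c < tight_frame_bound ip \<phi> \<mu> (closed_span scl \<phi> \<mu>)"
      using c(2) INF_lower[OF that] by (rule less_le_trans)
    then show ?thesis
      unfolding tight_frame_bound_def less_Sup_iff by auto
  qed
  then obtain A where Ac: "\<And>\<mu>. \<mu> \<in> P \<Longrightarrow> c < A \<mu>"
    and A: "\<forall>\<mu>\<in>P. frame_bounds ip \<phi> \<mu> (closed_span scl \<phi> \<mu>) (A \<mu>) (A \<mu>)"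
    by metis
  note comp = tight_components[OF bes span P A]
  have lower: "c * (norm x)\<^sup>2 \<le> energy \<phi> I x" for x
  proof (rule has_sum_mono)
    show "((\<lambda>\<mu>. c * (norm (inverse (A \<mu>) *\<^sub>R frame_op \<phi> \<mu> x))\<^sup>2) has_sum c * (norm x)\<^sup>2) P"
      by (rule has_sum_cmult_right[OF comp(4)])
    show "((\<lambda>\<mu>. energy \<phi> \<mu> x) has_sum energy \<phi> I x) P"
      unfolding energy_def using P bes
      by (intro has_sum_partition bessel_summable) (auto simp: orthogonal_tight_partition_def)
    fix \<mu> assume "\<mu> \<in> P"
    then show "c * (norm (inverse (A \<mu>) *\<^sub>R frame_op \<phi> \<mu> x))\<^sup>2 \<le> energy \<phi> \<mu> x"
      unfolding comp(2)[OF \<open>\<mu> \<in> P\<close>, of x] by (intro mult_right_mono less_imp_le[OF Ac]) auto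
  qed
  obtain B where B: "\<And>x. energy \<phi> I x \<le> B * (norm x)\<^sup>2"
    using bessel_bound[OF bes] by blast
  have "energy \<phi> I x \<le> max B c * (norm x)\<^sup>2" for x
    using B[of x] by (rule order_trans) (simp add: mult_right_mono)
  (* the maximum secures the order of the two bounds even if the space is {0} *)
  then have "frame_bounds ip \<phi> I UNIV c (max B c)"
    using c(1) lower bessel_summable[OF bes] by (auto simp: frame_bounds_def energy_def)
  then show "frame_for ip \<phi> I UNIV"
    unfolding frame_for_def by blast
qed

end

section \<open>Contractive multipliers and orthogonal sums of tight frames\<close>


theorem theorem4p4:
  fixes scl :: "'k::real_or_complex \<Rightarrow> 'h::banach \<Rightarrow> 'h"
    and ip :: "'h \<Rightarrow> 'h \<Rightarrow> 'k"
    and I :: "nat set"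
    and \<phi> :: "nat \<Rightarrow> 'h"
  assumes "hilbert_space scl ip"
    and "separable_space (euclidean :: 'h topology)"
    and "I = UNIV \<or> (\<exists>N. I = {1..N})"
    and "bessel ip \<phi> I"
    and "closed_span scl \<phi> I = UNIV"
  shows
   "let
      i = (\<forall>\<sigma> x. \<sigma> \<subseteq> I \<longrightarrow>
        norm (\<Sum>\<^sub>\<infinity>i\<in>\<sigma>. scl (ip x (\<phi> i)) (\<phi> i)) \<le> norm (\<Sum>\<^sub>\<infinity>i\<in>I. scl (ip x (\<phi> i)) (\<phi> i)));
      ii = (\<forall>(\<epsilon> :: nat \<Rightarrow> real) x. (\<forall>i\<in>I. \<epsilon> i \<in> {-1, 1}) \<longrightarrow>
        norm (\<Sum>\<^sub>\<infinity>i\<in>I. scl (of_real (\<epsilon> i) * ip x (\<phi> i)) (\<phi> i))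
          \<le> norm (\<Sum>\<^sub>\<infinity>i\<in>I. scl (ip x (\<phi> i)) (\<phi> i)));
      iii = (\<forall>(a :: nat \<Rightarrow> real) x. (\<forall>i\<in>I. \<bar>a i\<bar> \<le> 1) \<longrightarrow>
        norm (\<Sum>\<^sub>\<infinity>i\<in>I. scl (of_real (a i) * ip x (\<phi> i)) (\<phi> i))
          \<le> norm (\<Sum>\<^sub>\<infinity>i\<in>I. scl (ip x (\<phi> i)) (\<phi> i)));
      iv = (\<exists>P. orthogonal_tight_partition scl ip \<phi> I P)
    in
      (i \<longleftrightarrow> ii) \<and> (ii \<longleftrightarrow> iii) \<and> (iii \<longleftrightarrow> iv) \<and>
      (\<forall>P. orthogonal_tight_partition scl ip \<phi> I P \<longleftrightarrow>
        partition_on I P \<and>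
        hilbert_direct_sum scl ip (closed_span scl \<phi>) P \<and>
        (\<forall>\<mu>\<in>P. tight_frame_for ip \<phi> \<mu> (closed_span scl \<phi> \<mu>))) \<and>
      (i \<or> ii \<or> iii \<or> iv \<longrightarrow>
        (\<forall>P. orthogonal_tight_partition scl ip \<phi> I P \<longrightarrow>
          (frame_for ip \<phi> I UNIV \<longleftrightarrow>
            (INF \<mu>\<in>P. tight_frame_bound ip \<phi> \<mu> (closed_span scl \<phi> \<mu>)) \<noteq> 0)))"
proof -
  interpret hilbert_space scl ip by fact
  note bes = assms(4) and span = assms(5)
  have op: "(\<Sum>\<^sub>\<infinity>i\<in>\<sigma>. scl (ip x (\<phi> i)) (\<phi> i)) = frame_op \<phi> \<sigma> x" for \<sigma> x
    by (simp add: frame_op_def)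
  define i where "i \<longleftrightarrow> (\<forall>\<sigma> x. \<sigma> \<subseteq> I \<longrightarrow> norm (frame_op \<phi> \<sigma> x) \<le> norm (frame_op \<phi> I x))"
  define ii where "ii \<longleftrightarrow> (\<forall>(\<epsilon> :: nat \<Rightarrow> real) x. (\<forall>i\<in>I. \<epsilon> i \<in> {-1, 1}) \<longrightarrow>
    norm (\<Sum>\<^sub>\<infinity>i\<in>I. scl (of_real (\<epsilon> i) * ip x (\<phi> i)) (\<phi> i)) \<le> norm (frame_op \<phi> I x))"
  define iii where "iii \<longleftrightarrow> (\<forall>(a :: nat \<Rightarrow> real) x. (\<forall>i\<in>I. \<bar>a i\<bar> \<le> 1) \<longrightarrow>
    norm (\<Sum>\<^sub>\<infinity>i\<in>I. scl (of_real (a i) * ip x (\<phi> i)) (\<phi> i)) \<le> norm (frame_op \<phi> I x))"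
  define iv where "iv \<longleftrightarrow> (\<exists>P. orthogonal_tight_partition scl ip \<phi> I P)"
  have one_point: iv
    if "0 < e" and "\<And>k x. k \<in> I \<Longrightarrow>
      norm (\<Sum>\<^sub>\<infinity>i\<in>I. scl (of_real (if i = k then 1 - e else 1) * ip x (\<phi> i)) (\<phi> i)) \<le> norm (frame_op \<phi> I x)"
    for e :: real
    unfolding iv_def
  proof (intro eigenvectors_imp_orthogonal_tight_partition[OF bes] eigenvector_of_frame_op[OF bes \<open>0 < e\<close>])
    fix k x assume "k \<in> I"
    then show "norm (frame_op \<phi> I x - e *\<^sub>R scl (ip x (\<phi> k)) (\<phi> k)) \<le> norm (frame_op \<phi> I x)"
      using that(2) multiplier_one_point[OF bes] by simp
  qed
  (* e = 1 drops the index k, e = 2 flips its sign *)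
  have i_iv: iv if i
  proof (rule one_point[of 1])
    fix k x assume "k \<in> I"
    have "(\<Sum>\<^sub>\<infinity>i\<in>I. scl (of_real (if i = k then 1 - 1 else 1) * ip x (\<phi> i)) (\<phi> i)) = frame_op \<phi> (I - {k}) x"
      unfolding frame_op_def by (rule infsum_cong_neutral) auto
    then show "norm (\<Sum>\<^sub>\<infinity>i\<in>I. scl (of_real (if i = k then 1 - 1 else 1) * ip x (\<phi> i)) (\<phi> i)) \<le> norm (frame_op \<phi> I x)"
      using \<open>i\<close> unfolding i_def by (metis Diff_subset)
  qed simp
  have ii_iv: iv if ii
    by (rule one_point[of 2]) (use \<open>ii\<close> in \<open>auto simp: ii_def\<close>)
  have iv_iii: iii if iv
    using \<open>iv\<close> orthogonal_tight_partition_multiplier_le[OF bes] unfolding iv_def iii_def by blast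
  have iii_ii: ii if iii
    unfolding ii_def
  proof (intro allI impI)
    fix \<epsilon> :: "nat \<Rightarrow> real" and x
    assume "\<forall>i\<in>I. \<epsilon> i \<in> {-1, 1}"
    then have "\<forall>i\<in>I. \<bar>\<epsilon> i\<bar> \<le> 1"
      by fastforce
    with \<open>iii\<close> show "norm (\<Sum>\<^sub>\<infinity>i\<in>I. scl (of_real (\<epsilon> i) * ip x (\<phi> i)) (\<phi> i)) \<le> norm (frame_op \<phi> I x)"
      unfolding iii_def by blast
  qed
  have iii_i: i if iii
    unfolding i_def
  proof (intro allI impI)
    fix \<sigma> x assume "\<sigma> \<subseteq> I"
    then have "frame_op \<phi> \<sigma> x = (\<Sum>\<^sub>\<infinity>i\<in>I. scl (of_real (indicator \<sigma> i) * ip x (\<phi> i)) (\<phi> i))"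
      unfolding frame_op_def by (intro infsum_cong_neutral) auto
    with \<open>iii\<close> show "norm (frame_op \<phi> \<sigma> x) \<le> norm (frame_op \<phi> I x)"
      unfolding iii_def by (simp add: indicator_def)
  qed
  have "(i \<longleftrightarrow> ii) \<and> (ii \<longleftrightarrow> iii) \<and> (iii \<longleftrightarrow> iv)"
    using i_iv ii_iv iv_iii iii_ii iii_i by blast
  then show ?thesis
    unfolding Let_def op
    unfolding i_def[symmetric] ii_def[symmetric] iii_def[symmetric] iv_def[symmetric]
    using orthogonal_tight_partition_iff_direct_sum[OF bes span] frame_for_UNIV_iff_INF_tight_bounds[OF bes span]
    by blast
qed

end
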